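(* Let $\varphi\in\Phi$ and $\psi\in\Phi$. If $\psi$ is convex on $(0,+\infty)$, then $$\inf_{x\in(0,+\infty)}\bigl(\varphi(x)-\psi(x)\bigr)=\inf_{x\in(0,+\infty)}\bigl(\varphi^{**}(x)-\psi(x)\bigr).$$
   Context: $\Phi$ is the set of all functions $\varphi:(0,+\infty)\to\mathbb{R}$ (no continuity assumed) for which there exists a real number $a$ with $\inf_{x\in(0,+\infty)}(\varphi(x)-ax)>-\infty$. For $\varphi\in\Phi$ let $M_\varphi=\{(a,b)\in\mathbb{R}^2 : \inf_{t\in(0,+\infty)}(\varphi(t)-at)>b\}$, and define $\varphi^{**}:(0,+\infty)\to\mathbb{R}$ by $\varphi^{**}(x)=\sup_{(a,b)\in M_\varphi}(ax+b)$. Infima are taken in $\mathbb{R}\cup\{-\infty\}$ (both sides may equal $-\infty$). *)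

theory Defs
  imports "HOL-Analysis.Analysis"
begin

text \<open>
  Functions on $(0,+\infty)$ are represented by functions of type \<^typ>\<open>real \<Rightarrow> real\<close> of which only
  the values on \<^term>\<open>{0<..} :: real set\<close> are used. Infima that may equal $-\infty$ are taken in
  \<^typ>\<open>ereal\<close>.
\<close>

definition Phi :: "(real \<Rightarrow> real) set" where
  "Phi = {\<phi>. \<exists>a::real. (INF x\<in>{0<..}. ereal (\<phi> x - a * x)) > -\<infinity>}"

definition minorants :: "(real \<Rightarrow> real) \<Rightarrow> (real \<times> real) set" where
  "minorants \<phi> = {(a, b). (INF t\<in>{0<..}. ereal (\<phi> t - a * t)) > ereal b}"

text \<open>
  The supremum below is the real-valued one; for \<open>\<phi> \<in> Phi\<close> and \<open>x > 0\<close> it is taken over a nonempty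
  set bounded above by \<open>\<phi> x\<close> (see \<open>minorants_nonempty\<close> and \<open>minorants_bdd_above\<close>).
\<close>

definition biconj :: "(real \<Rightarrow> real) \<Rightarrow> real \<Rightarrow> real" where
  "biconj \<phi> x = (SUP (a, b)\<in>minorants \<phi>. a * x + b)"

lemma minorants_nonempty:
  assumes "\<phi> \<in> Phi"
  shows "minorants \<phi> \<noteq> {}"
proof -
  obtain a where "(INF x\<in>{0<..}. ereal (\<phi> x - a * x)) > -\<infinity>"
    using assms by (auto simp: Phi_def)
  then obtain b where "ereal b < (INF x\<in>{0<..}. ereal (\<phi> x - a * x))"
    using ereal_dense2 by blast
  then have "(a, b) \<in> minorants \<phi>"
    by (simp add: minorants_def)
  then show ?thesis by blast
qed

lemma minorants_le:
  assumes "(a, b) \<in> minorants \<phi>" "x > 0"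
  shows "a * x + b \<le> \<phi> x"
proof -
  have "ereal b < (INF t\<in>{0<..}. ereal (\<phi> t - a * t))"
    using assms by (simp add: minorants_def)
  also have "\<dots> \<le> ereal (\<phi> x - a * x)"
    using assms(2) by (intro INF_lower) simp
  finally show ?thesis by simp
qed

lemma minorants_bdd_above:
  assumes "x > 0"
  shows "bdd_above ((\<lambda>(a, b). a * x + b) ` minorants \<phi>)"
  using minorants_le[OF _ assms] by (intro bdd_aboveI[of _ "\<phi> x"]) auto

end

theory Submission
  imports Defs
begin

text \<open>
  Every minorant lies below \<open>\<phi>\<close>, so \<open>biconj \<phi> \<le> \<phi>\<close> and the right-hand infimum is at most the
  left-hand one. Conversely, if \<open>\<phi> \<ge> \<psi> + m\<close>, then a supporting line of the convex function \<open>\<psi>\<close> at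
  a point \<open>x\<close>, raised by \<open>m - e\<close> with \<open>e > 0\<close>, is a minorant of \<open>\<phi>\<close>; hence
  \<open>biconj \<phi> x \<ge> \<psi> x + m - e\<close> for every \<open>e > 0\<close>.
\<close>

lemma biconj_le:
  assumes "\<phi> \<in> Phi" "x > 0"
  shows "biconj \<phi> x \<le> \<phi> x"
  unfolding biconj_def
  using minorants_nonempty[OF assms(1)] minorants_le[OF _ assms(2)]
  by (intro cSUP_least) auto

lemma minorant_le_biconj:
  assumes "(a, b) \<in> minorants \<phi>" "x > 0"
  shows "a * x + b \<le> biconj \<phi> x"
  unfolding biconj_def
  using cSUP_upper[OF assms(1) minorants_bdd_above[OF assms(2)]] by simp

text \<open>A pointwise bound only gives that the infimum is at least \<open>c\<close>, possibly
  with equality; the gap \<open>b < c\<close> supplies the strictness built into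
  \<open>minorants\<close>.\<close>

lemma minorantsI:
  assumes "\<And>t. t > 0 \<Longrightarrow> a * t + c \<le> \<phi> t" "b < c"
  shows "(a, b) \<in> minorants \<phi>"
proof -
  have "ereal b < ereal c" using assms(2) by simp
  also have "\<dots> \<le> (INF t\<in>{0<..}. ereal (\<phi> t - a * t))"
  proof (rule INF_greatest)
    fix t :: real
    assume "t \<in> {0<..}"
    then show "ereal c \<le> ereal (\<phi> t - a * t)"
      using assms(1)[of t] by simp
  qed
  finally show ?thesis by (simp add: minorants_def)
qed

text \<open>The slope is the infimum of the difference quotients to the right of \<open>x\<close>,
  that is, the right derivative.\<close>

lemma convex_on_supporting_line:
  fixes f :: "real \<Rightarrow> real"
  assumes "convex_on I f" "x \<in> interior I"
  obtains c where "\<And>t. t \<in> I \<Longrightarrow> f x + c * (t - x) \<le> f t"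
  using convex_le_Inf_differential[OF assms] that by blast

lemma convex_minorant_le_biconj:
  fixes \<psi> :: "real \<Rightarrow> real"
  assumes "convex_on {0<..} \<psi>" "\<And>t. t > 0 \<Longrightarrow> \<psi> t \<le> \<phi> t" "x > 0"
  shows "\<psi> x \<le> biconj \<phi> x"
proof (rule field_le_epsilon)
  fix e :: real
  assume "e > 0"
  obtain c where c: "\<And>t. t \<in> {0<..} \<Longrightarrow> \<psi> x + c * (t - x) \<le> \<psi> t"
    using convex_on_supporting_line[OF assms(1), of x] assms(3)
    by (auto simp: interior_open)
  \<comment> \<open>The supporting line at \<open>x\<close>, lowered by \<open>e\<close>; its value
    at \<open>x\<close> is \<open>\<psi> x - e\<close>.\<close>
  have "(c, \<psi> x - c * x - e) \<in> minorants \<phi>"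
  proof (rule minorantsI)
    fix t :: real
    assume "t > 0"
    then show "c * t + (\<psi> x - c * x) \<le> \<phi> t"
      using c[of t] assms(2)[of t] by (simp add: algebra_simps)
  qed (use \<open>e > 0\<close> in simp)
  from minorant_le_biconj[OF this assms(3)] show "\<psi> x \<le> biconj \<phi> x + e" by simp
qed

theorem theorem3p1:
  fixes \<phi> \<psi> :: "real \<Rightarrow> real"
  assumes "\<phi> \<in> Phi" and "\<psi> \<in> Phi"
    and "convex_on {0<..} \<psi>"
  shows "(INF x\<in>{0<..}. ereal (\<phi> x - \<psi> x)) = (INF x\<in>{0<..}. ereal (biconj \<phi> x - \<psi> x))"
proof (rule antisym)
  show "(INF x\<in>{0<..}. ereal (biconj \<phi> x - \<psi> x)) \<le> (INF x\<in>{0<..}. ereal (\<phi> x - \<psi> x))"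
    using biconj_le[OF assms(1)] by (intro INF_superset_mono) auto
next
  show "(INF x\<in>{0<..}. ereal (\<phi> x - \<psi> x)) \<le> (INF x\<in>{0<..}. ereal (biconj \<phi> x - \<psi> x))"
  proof (rule INF_greatest)
    fix x :: real
    assume "x \<in> {0<..}"
    show "(INF x\<in>{0<..}. ereal (\<phi> x - \<psi> x)) \<le> ereal (biconj \<phi> x - \<psi> x)"
    proof (rule ccontr)
      assume "\<not> ?thesis"
      \<comment> \<open>A real \<open>m\<close> strictly in between replaces the infimum itself, so
        the value -\<infinity> needs no separate case.\<close>
      then obtain m where m: "biconj \<phi> x - \<psi> x < m"
        and less: "ereal m < (INF x\<in>{0<..}. ereal (\<phi> x - \<psi> x))"
        using ereal_dense2[of "ereal (biconj \<phi> x - \<psi> x)"] by (auto simp: not_le)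
      have "\<psi> t + m \<le> \<phi> t" if "t > 0" for t
        using less_INF_D[OF less, of t] that by simp
      moreover have "convex_on {0<..} (\<lambda>t. \<psi> t + m)"
        using assms(3) by (intro convex_on_add convex_on_const[THEN iffD2]) auto
      ultimately have "\<psi> x + m \<le> biconj \<phi> x"
        using convex_minorant_le_biconj[of "\<lambda>t. \<psi> t + m" \<phi> x] \<open>x \<in> {0<..}\<close> by simp
      with m show False by simp
    qed
  qed
qed

end
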